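(* Let $G=(V,E)$ be a finite directed acyclic graph and let $\mathcal{A}$ be an $L_\infty$ isotonic operator on $G$. If $\mathcal{A}$ is monotonic on $G$ and preserves level set trimming on $G$, then for every weighted function $(f,w)$ on $G$ we have $\mathcal{A}(G,f,w)=\mathsf{strict}^{\uparrow\infty}(G,f,w)$ (and hence also $\mathcal{A}(G,f,w)=\mathsf{lex}_\infty(G,f,w)$).
   Context: A weighted function $(f,w)$ on $G$ consists of $f:V\to\mathbb{R}$ and $w:V\to(0,\infty)$. Write $u\prec v$ if there is a directed path from $u$ to $v$. A function $g:V\to\mathbb{R}$ is isotonic if $u\prec v$ implies $g(u)\le g(v)$. An $L_p$ isotonic regression of $(f,w)$ ($1<p<\infty$) is an isotonic $g$ minimizing $\sum_{v}w(v)|f(v)-g(v)|^p$ (it is unique for $1<p<\infty$); an $L_\infty$ isotonic regression is an isotonic $g$ minimizing $\max_v w(v)|f(v)-g(v)|$. $\mathsf{strict}^{\uparrow\infty}(G,f,w)$ denotes the pointwise limit as $p\to\infty$ of the $L_p$ isotonic regressions of $(f,w)$. $\mathsf{lex}_\infty(G,f,w)$ is the isotonic function $g$ that is minimal in the following order: $g\prec h$ iff there is $\alpha>0$ with $\sum\{w(v):|g(v)-f(v)|\ge\alpha\}<\sum\{w(v):|h(v)-f(v)|\ge\alpha\}$ and for all $\beta>\alpha$, $\sum\{w(v):|g(v)-f(v)|\ge\beta\}=\sum\{w(v):|h(v)-f(v)|\ge\beta\}$. An $L_\infty$ isotonic operator on $G$ is a map $\mathcal{A}$ assigning to every weighted function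 $(f,w)$ on $G$ an $L_\infty$ isotonic regression $\mathcal{A}(G,f,w)$ of $(f,w)$. $\mathcal{A}$ is monotonic on $G$ if for every weight function $w$ and all $f,g:V\to\mathbb{R}$ with $f\le g$ pointwise, $\mathcal{A}(G,f,w)\le\mathcal{A}(G,g,w)$ pointwise. For an isotonic $g$, a level set is a maximal weakly connected set of vertices on which $g$ is constant. For a finite set $L$ of weighted values, the weighted $L_\infty$ mean of $(f,w)|_L$ is the value $y$ minimizing $\max_{v\in L}w(v)|f(v)-y|$ (equivalently the limit as $q\to\infty$ of the weighted $L_q$ means). $\mathcal{A}$ preserves level set trimming on $G$ if for every weighted $(f,w)$ on $G$ and every level set $L$ of $\mathcal{A}(G,f,w)$, the value of $\mathcal{A}(G,f,w)$ on $L$ equals the weighted $L_\infty$ mean of $(f,w)|_L$.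
   Formalization: The strict regression is the limit of isotonic minimisers of Σ(w|f−g|)^p (weights w^p, not w), and lex∞ thresholds the weighted errors w|g−f|; with the literal formulas the claim fails for non-constant weights (edge a→b, f=(1,0), w=(1,2): 1/3 versus 1/2). *)

theory Defs
  imports Complex_Main
begin

text \<open>
  A graph is given by a vertex set \<open>V\<close> and an edge relation \<open>E\<close>.  Functions on the vertices are
  total functions \<open>'a \<Rightarrow> real\<close> of which only the values on \<open>V\<close> matter.
\<close>

definition finite_dag :: "'a set \<Rightarrow> ('a \<times> 'a) set \<Rightarrow> bool" where
  "finite_dag V E \<longleftrightarrow> finite V \<and> E \<subseteq> V \<times> V \<and> acyclic E"

definition weight_fun :: "'a set \<Rightarrow> ('a \<Rightarrow> real) \<Rightarrow> bool" where
  "weight_fun V w \<longleftrightarrow> (\<forall>v\<in>V. 0 < w v)"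

definition isotonic :: "('a \<times> 'a) set \<Rightarrow> ('a \<Rightarrow> real) \<Rightarrow> bool" where
  "isotonic E g \<longleftrightarrow> (\<forall>u v. (u, v) \<in> E\<^sup>+ \<longrightarrow> g u \<le> g v)"

definition Lp_err :: "'a set \<Rightarrow> real \<Rightarrow> ('a \<Rightarrow> real) \<Rightarrow> ('a \<Rightarrow> real) \<Rightarrow> ('a \<Rightarrow> real) \<Rightarrow> real" where
  "Lp_err V p f w g = (\<Sum>v\<in>V. w v * \<bar>f v - g v\<bar> powr p)"

definition Linf_err :: "'a set \<Rightarrow> ('a \<Rightarrow> real) \<Rightarrow> ('a \<Rightarrow> real) \<Rightarrow> ('a \<Rightarrow> real) \<Rightarrow> real" where
  "Linf_err V f w g = (MAX v\<in>V. w v * \<bar>f v - g v\<bar>)"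

definition Lp_isoreg ::
    "'a set \<Rightarrow> ('a \<times> 'a) set \<Rightarrow> real \<Rightarrow> ('a \<Rightarrow> real) \<Rightarrow> ('a \<Rightarrow> real) \<Rightarrow> ('a \<Rightarrow> real) \<Rightarrow> bool" where
  "Lp_isoreg V E p f w g \<longleftrightarrow> is_arg_min (Lp_err V p f w) (isotonic E) g"

definition Linf_isoreg ::
    "'a set \<Rightarrow> ('a \<times> 'a) set \<Rightarrow> ('a \<Rightarrow> real) \<Rightarrow> ('a \<Rightarrow> real) \<Rightarrow> ('a \<Rightarrow> real) \<Rightarrow> bool" where
  "Linf_isoreg V E f w g \<longleftrightarrow> is_arg_min (Linf_err V f w) (isotonic E) g"

text \<open>
  The limit \<open>p \<rightarrow> \<infinity>\<close> is taken of the \<open>L\<^sub>p\<close> regressions with weights \<open>w\<^sup>p\<close>, i.e. of the isotonic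
  minimisers of \<open>\<Sum>v. (w v * \<bar>f v - g v\<bar>)\<^sup>p\<close>: this is the weighted \<open>p\<close>-norm whose limit is the
  weighted supremum norm used in \<open>Linf_err\<close>.  With weights \<open>w\<close> that do not depend on \<open>p\<close>, the
  limit does not depend on \<open>w\<close>: for one edge \<open>a \<rightarrow> b\<close>, \<open>f a = 1\<close>, \<open>f b = 0\<close>, \<open>w a = 1\<close>,
  \<open>w b = 2\<close> it is the constant 1/2, while the only \<open>L\<^sub>\<infinity>\<close> isotonic regression is the constant 1/3.
  For the same reason the thresholds in \<open>lex_less\<close> are applied to the weighted errors.
\<close>

definition strict_isoreg ::
    "'a set \<Rightarrow> ('a \<times> 'a) set \<Rightarrow> ('a \<Rightarrow> real) \<Rightarrow> ('a \<Rightarrow> real) \<Rightarrow> ('a \<Rightarrow> real) \<Rightarrow> bool" where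
  "strict_isoreg V E f w g \<longleftrightarrow>
     (\<exists>h. (\<forall>p>1. Lp_isoreg V E p f (\<lambda>v. w v powr p) (h p)) \<and>
          (\<forall>v\<in>V. ((\<lambda>p. h p v) \<longlongrightarrow> g v) at_top))"

definition err_weight ::
    "'a set \<Rightarrow> ('a \<Rightarrow> real) \<Rightarrow> ('a \<Rightarrow> real) \<Rightarrow> ('a \<Rightarrow> real) \<Rightarrow> real \<Rightarrow> real" where
  "err_weight V f w g \<alpha> = (\<Sum>v\<in>{v\<in>V. \<alpha> \<le> w v * \<bar>g v - f v\<bar>}. w v)"

definition lex_less ::
    "'a set \<Rightarrow> ('a \<Rightarrow> real) \<Rightarrow> ('a \<Rightarrow> real) \<Rightarrow> ('a \<Rightarrow> real) \<Rightarrow> ('a \<Rightarrow> real) \<Rightarrow> bool" where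
  "lex_less V f w g h \<longleftrightarrow>
     (\<exists>\<alpha>>0. err_weight V f w g \<alpha> < err_weight V f w h \<alpha> \<and>
            (\<forall>\<beta>>\<alpha>. err_weight V f w g \<beta> = err_weight V f w h \<beta>))"

definition lex_minimal ::
    "'a set \<Rightarrow> ('a \<times> 'a) set \<Rightarrow> ('a \<Rightarrow> real) \<Rightarrow> ('a \<Rightarrow> real) \<Rightarrow> ('a \<Rightarrow> real) \<Rightarrow> bool" where
  "lex_minimal V E f w g \<longleftrightarrow> isotonic E g \<and> \<not> (\<exists>h. isotonic E h \<and> lex_less V f w h g)"

definition lex_isoreg ::
    "'a set \<Rightarrow> ('a \<times> 'a) set \<Rightarrow> ('a \<Rightarrow> real) \<Rightarrow> ('a \<Rightarrow> real) \<Rightarrow> ('a \<Rightarrow> real) \<Rightarrow> bool" where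
  "lex_isoreg V E f w g \<longleftrightarrow>
     lex_minimal V E f w g \<and> (\<forall>h. lex_minimal V E f w h \<longrightarrow> (\<forall>v\<in>V. h v = g v))"

type_synonym 'a operator = "('a \<Rightarrow> real) \<Rightarrow> ('a \<Rightarrow> real) \<Rightarrow> 'a \<Rightarrow> real"

definition Linf_isotonic_operator :: "'a set \<Rightarrow> ('a \<times> 'a) set \<Rightarrow> 'a operator \<Rightarrow> bool" where
  "Linf_isotonic_operator V E A \<longleftrightarrow>
     (\<forall>f w. weight_fun V w \<longrightarrow> Linf_isoreg V E f w (A f w))"

definition monotonic_operator :: "'a set \<Rightarrow> 'a operator \<Rightarrow> bool" where
  "monotonic_operator V A \<longleftrightarrow>
     (\<forall>w f g. weight_fun V w \<longrightarrow> (\<forall>v\<in>V. f v \<le> g v) \<longrightarrow> (\<forall>v\<in>V. A f w v \<le> A g w v))"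

definition weakly_connected :: "('a \<times> 'a) set \<Rightarrow> 'a set \<Rightarrow> bool" where
  "weakly_connected E S \<longleftrightarrow>
     S \<noteq> {} \<and> (\<forall>u\<in>S. \<forall>v\<in>S. (u, v) \<in> ((E \<union> E\<inverse>) \<inter> S \<times> S)\<^sup>*)"

definition level_set :: "'a set \<Rightarrow> ('a \<times> 'a) set \<Rightarrow> ('a \<Rightarrow> real) \<Rightarrow> 'a set \<Rightarrow> bool" where
  "level_set V E g L \<longleftrightarrow>
     (let P = (\<lambda>S. S \<subseteq> V \<and> weakly_connected E S \<and> (\<forall>u\<in>S. \<forall>v\<in>S. g u = g v))
      in P L \<and> (\<forall>M. P M \<and> L \<subseteq> M \<longrightarrow> M = L))"

definition Linf_mean :: "'a set \<Rightarrow> ('a \<Rightarrow> real) \<Rightarrow> ('a \<Rightarrow> real) \<Rightarrow> real \<Rightarrow> bool" where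
  "Linf_mean L f w y \<longleftrightarrow> is_arg_min (\<lambda>z. MAX v\<in>L. w v * \<bar>f v - z\<bar>) (\<lambda>_. True) y"

definition preserves_level_set_trimming ::
    "'a set \<Rightarrow> ('a \<times> 'a) set \<Rightarrow> 'a operator \<Rightarrow> bool" where
  "preserves_level_set_trimming V E A \<longleftrightarrow>
     (\<forall>f w L. weight_fun V w \<longrightarrow> level_set V E (A f w) L \<longrightarrow>
        (\<forall>v\<in>L. Linf_mean L f w (A f w v)))"

end

theory Submission
  imports Defs "HOL-Analysis.Function_Topology"
begin

text \<open>
  Call an isotonic \<open>s\<close> strictly minimal if, for every isotonic \<open>h\<close>, the largest weighted error of \<open>s\<close>
  on the set where \<open>h\<close> and \<open>s\<close> differ is smaller than that of \<open>h\<close>.  Every cluster point \<open>s\<close> of the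
  \<open>L\<^sub>p\<close> regressions \<open>h\<^sub>p\<close> is strictly minimal: if \<open>k\<close> were a counterexample, \<open>h\<^sub>p + (k - s) / 2\<close> would be
  isotonic for large \<open>p\<close> near the cluster point and have a smaller \<open>L\<^sub>p\<close> error than \<open>h\<^sub>p\<close>.  Strictly
  minimal functions are unique, so \<open>h\<^sub>p\<close> converges, and strict minimality gives lexicographic minimality.

  It remains to see that \<open>g = A f w\<close> is the strictly minimal \<open>s\<close>.  Among the vertices where they differ
  let \<open>x\<close> have the largest error \<open>\<gamma>\<close> under \<open>g\<close>; there all errors of \<open>s\<close> are below \<open>\<gamma>\<close>.  By
  duality assume \<open>f x < g x = c\<close>, so \<open>s x < c\<close>.  Raise \<open>f\<close> to a huge constant on \<open>{s \<ge> c}\<close>.  The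
  strictly minimal function of the new data still agrees with \<open>s\<close> at the vertices of \<open>{s < c}\<close> whose
  error under \<open>s\<close> is at least \<open>\<gamma>\<close>, and there, by induction on the number of such vertices, so does the
  new value of \<open>A\<close>.  By monotonicity the level set of \<open>x\<close> now has a value \<open>c' \<ge> c\<close>, and it lies in
  \<open>{s < c}\<close>.  Trimming yields a vertex \<open>y\<close> of it with \<open>w y * (f y - c') \<ge> \<gamma>\<close>; since \<open>s y < c\<close>, its
  error under \<open>s\<close> is at least \<open>\<gamma>\<close>, so \<open>A\<close> takes the value \<open>s y < c\<close> at \<open>y\<close> instead of \<open>c'\<close>.
\<close>

section \<open>Strictly minimal functions and their uniqueness\<close>

definition werr :: "('a \<Rightarrow> real) \<Rightarrow> ('a \<Rightarrow> real) \<Rightarrow> ('a \<Rightarrow> real) \<Rightarrow> 'a \<Rightarrow> real" where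
  "werr f w g v = w v * \<bar>f v - g v\<bar>"

lemma werr_nonneg: "weight_fun V w \<Longrightarrow> v \<in> V \<Longrightarrow> 0 \<le> werr f w g v"
  by (simp add: werr_def weight_fun_def less_imp_le)

text \<open>An arbitrary bound \<gamma> stands in for the largest error of \<open>h\<close> on the
  difference set. This avoids a maximum over a set that is empty when \<open>h\<close> and
  \<open>s\<close> agree on \<open>V\<close>.\<close>

definition strictly_minimal ::
    "'a set \<Rightarrow> ('a \<times> 'a) set \<Rightarrow> ('a \<Rightarrow> real) \<Rightarrow> ('a \<Rightarrow> real) \<Rightarrow> ('a \<Rightarrow> real) \<Rightarrow> bool" where
  "strictly_minimal V E f w s \<longleftrightarrow> isotonic E s \<and>
     (\<forall>h \<gamma>. isotonic E h \<longrightarrow> (\<forall>v\<in>V. h v \<noteq> s v \<longrightarrow> werr f w h v \<le> \<gamma>) \<longrightarrow>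
        (\<forall>v\<in>V. h v \<noteq> s v \<longrightarrow> werr f w s v < \<gamma>))"

lemma strictly_minimalD:
  assumes "strictly_minimal V E f w s" "isotonic E h"
    "\<And>v. v \<in> V \<Longrightarrow> h v \<noteq> s v \<Longrightarrow> werr f w h v \<le> \<gamma>" "v \<in> V" "h v \<noteq> s v"
  shows "werr f w s v < \<gamma>"
  using assms unfolding strictly_minimal_def by blast

lemma finite_argmax:
  fixes e :: "'a \<Rightarrow> real"
  assumes "finite V" "z \<in> V" "P z"
  shows "\<exists>x\<in>V. P x \<and> (\<forall>v\<in>V. P v \<longrightarrow> e v \<le> e x)"
proof -
  have fin: "finite (e ` {v\<in>V. P v})" and ne: "e ` {v\<in>V. P v} \<noteq> {}"
    using assms by auto
  obtain x where "x \<in> V" "P x" "e x = Max (e ` {v\<in>V. P v})"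
    using Max_in[OF fin ne] by auto
  then show ?thesis
    using Max_ge[OF fin] by (intro bexI[of _ x]) auto
qed

text \<open>Each function serves as competitor of the other: on the difference set the errors of
  \<open>s'\<close> lie below the largest error of \<open>s\<close>, so the errors of
  \<open>s\<close> do too, which is absurd at the maximum.\<close>

lemma strictly_minimal_unique:
  assumes "finite V" "strictly_minimal V E f w s" "strictly_minimal V E f w s'" "v \<in> V"
  shows "s v = s' v"
proof (rule ccontr)
  assume ne: "s v \<noteq> s' v"
  obtain x where x: "x \<in> V" "s x \<noteq> s' x" "\<And>v. v \<in> V \<Longrightarrow> s v \<noteq> s' v \<Longrightarrow> werr f w s v \<le> werr f w s x"
    using finite_argmax[of V v "\<lambda>v. s v \<noteq> s' v" "werr f w s"] assms(1,4) ne by blast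
  have iso: "isotonic E s" "isotonic E s'"
    using assms(2,3) by (auto simp: strictly_minimal_def)
  have lt: "werr f w s' u < werr f w s x" if "u \<in> V" "s u \<noteq> s' u" for u
    using strictly_minimalD[OF assms(3) iso(1), of "werr f w s x"] x that by blast
  have "werr f w s x < werr f w s x"
    using strictly_minimalD[OF assms(2) iso(2), of "werr f w s x" x] lt x by force
  then show False by simp
qed

subsection \<open>Limits of \<open>L\<^sub>p\<close> regressions\<close>

text \<open>Tychonoff: the box is a product of compact intervals over the whole type, and
  isotonicity is an intersection of closed conditions on pairs of coordinates.\<close>

lemma compact_isotonic_box: "compact {k. isotonic E k \<and> (\<forall>v. k v \<in> {-B..B::real})}"
proof -
  have "compactin (product_topology (\<lambda>_. euclidean) UNIV) (PiE UNIV (\<lambda>_::'a. {-B..B}))"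
    by (subst compactin_PiE) (auto)
  then have comp: "compact (PiE UNIV (\<lambda>_::'a. {-B..B}))"
    by (simp add: euclidean_product_topology)
  have "closed (\<Inter>e\<in>E\<^sup>+. {k::'a \<Rightarrow> real. k (fst e) \<le> k (snd e)})"
    by (intro closed_INT ballI closed_Collect_le continuous_on_product_coordinates)
  from compact_Int_closed[OF comp this]
  show ?thesis
    by (rule back_subst[of compact]) (force simp: isotonic_def)
qed

lemma isotonic_clip: "isotonic E k \<Longrightarrow> isotonic E (\<lambda>v. max a (min b (k v)))"
  unfolding isotonic_def by (meson max.mono min.mono order_refl)

text \<open>A continuous function attains its minimum on the compact box. Clipping an isotonic
  competitor to the range of the box brings it no farther from \<open>f\<close> at any vertex, so
  this minimum is global.\<close>

lemma Lp_isoreg_exists: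
  assumes "finite V" "p > 1" "\<And>v. v \<in> V \<Longrightarrow> 0 \<le> W v" "\<And>v. v \<in> V \<Longrightarrow> \<bar>f v\<bar> \<le> B" "0 \<le> B"
  shows "\<exists>k. Lp_isoreg V E p f W k \<and> (\<forall>v. k v \<in> {-B..B})"
proof -
  let ?K = "{k. isotonic E k \<and> (\<forall>v. k v \<in> {-B..B::real})}"
  have cont: "continuous_on ?K (Lp_err V p f W)"
    unfolding Lp_err_def using \<open>p > 1\<close>
    by (intro continuous_on_sum continuous_on_mult continuous_on_powr' continuous_on_const
        continuous_on_rabs continuous_on_diff)
      (auto intro: continuous_on_subset[OF continuous_on_product_coordinates])
  have "(\<lambda>_. 0) \<in> ?K"
    using \<open>0 \<le> B\<close> by (auto simp: isotonic_def)
  then obtain k where k: "k \<in> ?K" "\<And>h. h \<in> ?K \<Longrightarrow> Lp_err V p f W k \<le> Lp_err V p f W h"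
    using continuous_attains_inf[OF compact_isotonic_box _ cont] by blast
  have "Lp_err V p f W k \<le> Lp_err V p f W h" if "isotonic E h" for h
  proof -
    let ?h = "\<lambda>v. max (-B) (min B (h v))"
    have "?h \<in> ?K"
      using isotonic_clip[OF that] \<open>0 \<le> B\<close> by auto
    then have "Lp_err V p f W k \<le> Lp_err V p f W ?h" by (rule k)
    also have "\<dots> \<le> Lp_err V p f W h"
      unfolding Lp_err_def
    proof (intro sum_mono mult_left_mono powr_mono2)
      fix v assume "v \<in> V"
      then show "\<bar>f v - ?h v\<bar> \<le> \<bar>f v - h v\<bar>"
        using assms(4)[of v] by (auto simp: max_def min_def abs_if split: if_splits)
    qed (use assms in auto)
    finally show ?thesis .
  qed
  then show ?thesis
    using k(1) by (auto simp: Lp_isoreg_def is_arg_min_linorder)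
qed

text \<open>The filter version of extracting a convergent subsequence: \<open>F\<close> is refined
  by the preimages under \<open>h\<close> of the neighbourhoods of a cluster point.\<close>

lemma compact_cluster_filter:
  fixes h :: "'p \<Rightarrow> 'b::topological_space"
  assumes "compact K" "F \<noteq> bot" "eventually (\<lambda>p. h p \<in> K) F"
  obtains s F' where "F' \<le> F" "F' \<noteq> bot" "(h \<longlongrightarrow> s) F'"
proof -
  have "filtermap h F \<noteq> bot" "eventually (\<lambda>x. x \<in> K) (filtermap h F)"
    using assms by (auto simp: filtermap_bot_iff eventually_filtermap)
  then obtain s where s: "inf (nhds s) (filtermap h F) \<noteq> bot"
    using assms(1) unfolding compact_filter by blast
  let ?F = "inf F (filtercomap h (nhds s))"
  have "?F \<noteq> bot"
  proof
    assume "?F = bot"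
    then obtain Q R where QR: "eventually Q F" "eventually R (filtercomap h (nhds s))"
        "\<And>p. \<not> (Q p \<and> R p)"
      by (auto simp: trivial_limit_def eventually_inf)
    then obtain R' where R': "eventually R' (nhds s)" "\<And>p. R' (h p) \<Longrightarrow> R p"
      by (auto simp: eventually_filtercomap)
    have "eventually (\<lambda>y. \<not> R' y) (filtermap h F)"
      unfolding eventually_filtermap using QR(1) by eventually_elim (use QR(3) R'(2) in blast)
    then have "eventually (\<lambda>_. False) (inf (nhds s) (filtermap h F))"
      unfolding eventually_inf using R'(1) by blast
    then show False
      using s by (simp add: trivial_limit_def)
  qed
  moreover have "(h \<longlongrightarrow> s) ?F"
    by (rule filterlim_mono[OF filterlim_filtercomap]) auto
  ultimately show thesis
    using that[of ?F s] by auto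
qed

text \<open>Strict convexity: the midpoint of two distinct points of a closed interval lies in its
  interior.\<close>

lemma midpoint_closer:
  fixes a b c r :: real
  assumes "\<bar>a - b\<bar> \<le> r" "\<bar>a - c\<bar> \<le> r" "c \<noteq> b"
  shows "\<bar>a - (b + (c - b) / 2)\<bar> < r"
  using assms by (cases "b < c") (auto simp: abs_le_iff abs_less_iff field_simps)

text \<open>The competitor \<open>m p\<close> differs from \<open>h p\<close> only on
  \<open>D\<close>. There its errors eventually stay below \<open>\<rho>1\<close>, while
  \<open>h p\<close> has an error above \<open>\<rho>2 > \<rho>1\<close> at \<open>y\<close>; for
  large \<open>p\<close> the powers of this one error outweigh the whole sum for
  \<open>m p\<close>.\<close>

lemma cluster_point_strictly_minimal:
  fixes F :: "real filter"
  assumes dag: "finite_dag V E" and w: "weight_fun V w"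
    and F: "F \<noteq> bot" "F \<le> at_top"
    and h: "\<And>p. p > 1 \<Longrightarrow> Lp_isoreg V E p f (\<lambda>v. w v powr p) (h p)"
    and lim: "\<And>v. v \<in> V \<Longrightarrow> ((\<lambda>p. h p v) \<longlongrightarrow> s v) F"
  shows "strictly_minimal V E f w s"
proof -
  have finV: "finite V" and sub: "E\<^sup>+ \<subseteq> V \<times> V"
    using dag trancl_subset_Sigma[of E V] by (auto simp: finite_dag_def)
  then have finE: "finite (E\<^sup>+)"
    using finite_subset by blast
  have wpos: "w v > 0" if "v \<in> V" for v
    using w that by (auto simp: weight_fun_def)
  have ev1: "eventually (\<lambda>p. p > 1) F"
    using F(2) eventually_gt_at_top filter_leD by blast
  have hiso: "isotonic E (h p)" if "p > 1" for p
    using h[OF that] by (simp add: Lp_isoreg_def is_arg_min_linorder)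
  have siso: "isotonic E s"
    unfolding isotonic_def
  proof (intro allI impI)
    fix u v assume uv: "(u, v) \<in> E\<^sup>+"
    have "eventually (\<lambda>p. h p u \<le> h p v) F"
      using ev1 by eventually_elim (use hiso uv in \<open>auto simp: isotonic_def\<close>)
    with uv sub show "s u \<le> s v"
      by (intro tendsto_le[OF F(1) lim[of v] lim[of u]]) auto
  qed
  have "werr f w s x < \<gamma>"
    if kiso: "isotonic E k" and kle: "\<And>v. v \<in> V \<Longrightarrow> k v \<noteq> s v \<Longrightarrow> werr f w k v \<le> \<gamma>"
      and x: "x \<in> V" "k x \<noteq> s x" for k \<gamma> x
  proof (rule ccontr)
    assume "\<not> werr f w s x < \<gamma>"
    then have ge: "werr f w s x \<ge> \<gamma>" by simp
    obtain y where y: "y \<in> V" "k y \<noteq> s y"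
      "\<And>v. v \<in> V \<Longrightarrow> k v \<noteq> s v \<Longrightarrow> werr f w s v \<le> werr f w s y"
      using finite_argmax[of V x "\<lambda>v. k v \<noteq> s v" "werr f w s"] finV x by blast
    \<comment> \<open>This \<alpha> bounds the errors of both \<open>s\<close> and \<open>k\<close>
      on \<open>D\<close>, since \<gamma> is at most the error of \<open>s\<close> at
      \<open>x\<close>. \<open>m'\<close> is the limit of \<open>m p\<close> on
      \<open>V\<close>.\<close>
    define \<alpha> where "\<alpha> = werr f w s y"
    define m where "m = (\<lambda>p v. h p v + (k v - s v) / 2)"
    define m' where "m' = (\<lambda>v. s v + (k v - s v) / 2)"
    define D where "D = {v\<in>V. k v \<noteq> s v}"
    have D: "finite D" "D \<subseteq> V" "y \<in> D"
      using finV y by (auto simp: D_def)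
    have mlim: "((\<lambda>p. m p v) \<longlongrightarrow> m' v) F" if "v \<in> V" for v
      unfolding m_def m'_def using lim[OF that] by (intro tendsto_intros)
    have m'lt: "werr f w m' v < \<alpha>" if "v \<in> D" for v
    proof -
      have v: "v \<in> V" "k v \<noteq> s v" "w v > 0"
        using that wpos by (auto simp: D_def)
      have 1: "w v * \<bar>f v - s v\<bar> \<le> \<alpha>"
        using y(3)[OF v(1,2)] by (simp add: \<alpha>_def werr_def)
      have 2: "w v * \<bar>f v - k v\<bar> \<le> \<alpha>"
        using kle[OF v(1,2)] y(3)[OF x] ge by (simp add: \<alpha>_def werr_def)
      have "\<bar>f v - s v\<bar> \<le> \<alpha> / w v" "\<bar>f v - k v\<bar> \<le> \<alpha> / w v"
        using 1 2 v(3) by (auto simp: field_simps)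
      then have "\<bar>f v - m' v\<bar> < \<alpha> / w v"
        using midpoint_closer v(2) unfolding m'_def by metis
      then show ?thesis
        using v(3) by (simp add: werr_def field_simps)
    qed
    obtain z where z: "z \<in> D" "\<And>v. v \<in> D \<Longrightarrow> werr f w m' v \<le> werr f w m' z"
      using finite_argmax[of D y "\<lambda>_. True" "werr f w m'"] D by blast
    define \<rho> where "\<rho> = werr f w m' z"
    have "0 \<le> \<rho>"
      using werr_nonneg[OF w] D(2) z(1) by (auto simp: \<rho>_def)
    have "\<rho> < \<alpha>"
      unfolding \<rho>_def by (rule m'lt[OF z(1)])
    \<comment> \<open>Two separate levels are inserted so that the ratio
      \<open>\<rho>2 / \<rho>1\<close> exceeds 1 and its powers absorb the factor
      \<open>card D\<close>.\<close>
    then obtain \<rho>1 where \<rho>1: "\<rho> < \<rho>1" "\<rho>1 < \<alpha>"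
      using dense by blast
    then obtain \<rho>2 where \<rho>2: "\<rho>1 < \<rho>2" "\<rho>2 < \<alpha>"
      using dense by blast
    have pos: "0 < \<rho>1" "0 < \<rho>2"
      using \<open>0 \<le> \<rho>\<close> \<rho>1 \<rho>2 by auto
    have ev_m: "\<forall>\<^sub>F p in F. \<forall>v\<in>D. werr f w (m p) v < \<rho>1"
    proof (rule eventually_ball_finite[OF D(1)], rule ballI)
      fix v assume v: "v \<in> D"
      have "((\<lambda>p. werr f w (m p) v) \<longlongrightarrow> werr f w m' v) F"
        unfolding werr_def using mlim v D(2) by (intro tendsto_intros) auto
      then show "\<forall>\<^sub>F p in F. werr f w (m p) v < \<rho>1"
        by (rule order_tendstoD) (use z(2)[OF v] \<rho>1 \<rho>_def in auto)
    qed
    have "((\<lambda>p. werr f w (h p) y) \<longlongrightarrow> \<alpha>) F"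
      unfolding werr_def \<alpha>_def using lim y(1) by (intro tendsto_intros) auto
    then have ev_h: "\<forall>\<^sub>F p in F. \<rho>2 < werr f w (h p) y"
      by (rule order_tendstoD) (use \<rho>2 in auto)
    have ev_iso: "\<forall>\<^sub>F p in F. \<forall>e\<in>E\<^sup>+. m p (fst e) \<le> m p (snd e)"
    proof (rule eventually_ball_finite[OF finE], rule ballI)
      fix e assume e: "e \<in> E\<^sup>+"
      obtain u v where uv: "e = (u, v)" by (cases e)
      have V: "u \<in> V" "v \<in> V" and le: "s u \<le> s v" "k u \<le> k v"
        using e uv sub siso kiso by (auto simp: isotonic_def)
      show "\<forall>\<^sub>F p in F. m p (fst e) \<le> m p (snd e)"
      \<comment> \<open>A strict inequality persists near the limit. Where \<open>s u = s v\<close>,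
        the increment \<open>(k - s) / 2\<close> is itself ordered and is added to the isotonic
        \<open>h p\<close>.\<close>
      proof (cases "s u < s v")
        case True
        then have "m' u < m' v"
          using le by (simp add: m'_def field_simps)
        then have "\<forall>\<^sub>F p in F. m p u < (m' u + m' v) / 2" "\<forall>\<^sub>F p in F. (m' u + m' v) / 2 < m p v"
          using order_tendstoD(2)[OF mlim[OF V(1)], of "(m' u + m' v) / 2"]
            order_tendstoD(1)[OF mlim[OF V(2)], of "(m' u + m' v) / 2"] by simp_all
        then show ?thesis
          by eventually_elim (simp add: uv)
      next
        case False
        show ?thesis
          using ev1
        proof eventually_elim
          case (elim p)
          then have "h p u \<le> h p v"
            using hiso[of p] e uv by (auto simp: isotonic_def)
          moreover have "(k u - s u) / 2 \<le> (k v - s v) / 2"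
            using False le by (intro divide_right_mono) auto
          ultimately show ?case
            by (simp add: uv m_def add_mono)
        qed
      qed
    qed
    have ev_pow: "\<forall>\<^sub>F p in F. real (card D) * \<rho>1 powr p < \<rho>2 powr p"
    proof -
      have "filterlim (\<lambda>p. exp (ln (\<rho>2 / \<rho>1) * p)) at_top at_top"
        using pos \<rho>2 by (intro filterlim_compose[OF exp_at_top]
            filterlim_tendsto_pos_mult_at_top[OF tendsto_const] filterlim_ident) auto
      then have "\<forall>\<^sub>F p in at_top. real (card D) < exp (ln (\<rho>2 / \<rho>1) * p)"
        by (auto simp: filterlim_at_top_dense)
      then have "\<forall>\<^sub>F p in F. real (card D) < exp (ln (\<rho>2 / \<rho>1) * p)"
        using F(2) filter_leD by blast
      then show ?thesis
      proof eventually_elim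
        case (elim p)
        have "exp (ln (\<rho>2 / \<rho>1) * p) = \<rho>2 powr p / \<rho>1 powr p"
          using pos by (simp add: powr_def ln_div exp_diff[symmetric] algebra_simps)
        with elim have "real (card D) < \<rho>2 powr p / \<rho>1 powr p"
          by (simp only:)
        with pos show ?case
          by (simp add: pos_less_divide_eq)
      qed
    qed
    have "\<forall>\<^sub>F p in F. False"
      using ev1 ev_m ev_h ev_iso ev_pow
    proof eventually_elim
      case (elim p)
      have "isotonic E (m p)"
        using elim(4) by (force simp: isotonic_def)
      then have le: "Lp_err V p f (\<lambda>v. w v powr p) (h p) \<le> Lp_err V p f (\<lambda>v. w v powr p) (m p)"
        using h[OF elim(1)] by (simp add: Lp_isoreg_def is_arg_min_linorder)
      \<comment> \<open>The weights \<open>w v powr p\<close> make the objective a sum of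
        \<open>p\<close>-th powers of weighted errors; the part off \<open>D\<close> is common to
        \<open>h p\<close> and \<open>m p\<close>.\<close>
      have eq: "Lp_err V p f (\<lambda>v. w v powr p) g =
          (\<Sum>v\<in>D. werr f w g v powr p) + (\<Sum>v\<in>V-D. werr f w g v powr p)" for g
        unfolding Lp_err_def using sum.subset_diff[OF D(2) finV] wpos
        by (simp add: werr_def powr_mult less_imp_le add.commute cong: sum.cong)
      have "(\<Sum>v\<in>V-D. werr f w (m p) v powr p) = (\<Sum>v\<in>V-D. werr f w (h p) v powr p)"
        by (rule sum.cong) (auto simp: D_def m_def werr_def)
      then have le': "(\<Sum>v\<in>D. werr f w (h p) v powr p) \<le> (\<Sum>v\<in>D. werr f w (m p) v powr p)"
        using le unfolding eq by simp
      have "\<rho>2 powr p \<le> werr f w (h p) y powr p"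
        using elim pos by (intro powr_mono2) auto
      also have "\<dots> \<le> (\<Sum>v\<in>D. werr f w (h p) v powr p)"
        by (rule member_le_sum) (use D in auto)
      also note le'
      also have "(\<Sum>v\<in>D. werr f w (m p) v powr p) \<le> (\<Sum>v\<in>D. \<rho>1 powr p)"
        using elim wpos D(2)
        by (intro sum_mono powr_mono2) (auto simp: less_imp_le subset_iff intro: werr_nonneg[OF w])
      finally show False
        using elim by simp
    qed
    then show False
      using F(1) by (simp add: trivial_limit_def)
  qed
  then show ?thesis
    using siso unfolding strictly_minimal_def by blast
qed

text \<open>All minimisers are chosen in one compact box, so every refinement of
  \<open>at_top\<close> has a cluster point. These are strictly minimal, hence equal on
  \<open>V\<close>, which forces convergence there.\<close>

lemma Lp_limit_strictly_minimal:
  assumes dag: "finite_dag V E" and w: "weight_fun V w"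
  shows "\<exists>s. strictly_minimal V E f w s \<and> strict_isoreg V E f w s"
proof -
  have finV: "finite V"
    using dag by (simp add: finite_dag_def)
  define B where "B = (\<Sum>v\<in>V. \<bar>f v\<bar>)"
  have B: "0 \<le> B" "\<And>v. v \<in> V \<Longrightarrow> \<bar>f v\<bar> \<le> B"
    unfolding B_def by (auto intro: sum_nonneg member_le_sum[OF _ _ finV])
  let ?K = "{k. isotonic E k \<and> (\<forall>v. k v \<in> {-B..B::real})}"
  have "\<forall>p. \<exists>k. p > 1 \<longrightarrow> Lp_isoreg V E p f (\<lambda>v. w v powr p) k \<and> (\<forall>v. k v \<in> {-B..B})"
    using Lp_isoreg_exists[OF finV, of _ _ f B E] B by (metis powr_ge_zero)
  then obtain h where h: "\<And>p. p > 1 \<Longrightarrow> Lp_isoreg V E p f (\<lambda>v. w v powr p) (h p)"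
      "\<And>p v. p > 1 \<Longrightarrow> h p v \<in> {-B..B}"
    by metis
  have hK: "h p \<in> ?K" if "p > 1" for p
    using h[OF that] by (auto simp: Lp_isoreg_def is_arg_min_linorder)
  have cluster: "\<exists>s F'. F' \<le> F \<and> F' \<noteq> bot \<and>
      (\<forall>v. ((\<lambda>p. h p v) \<longlongrightarrow> s v) F') \<and> strictly_minimal V E f w s"
    if F: "F \<noteq> bot" "F \<le> at_top" for F
  proof -
    have "eventually (\<lambda>p. p > 1) F"
      using F(2) eventually_gt_at_top filter_leD by blast
    then have "eventually (\<lambda>p. h p \<in> ?K) F"
      by eventually_elim (rule hK)
    from compact_cluster_filter[OF compact_isotonic_box F(1) this]
    obtain s F' where F': "F' \<le> F" "F' \<noteq> bot" "(h \<longlongrightarrow> s) F'" .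
    have lim: "((\<lambda>p. h p v) \<longlongrightarrow> s v) F'" for v
      by (rule continuous_on_tendsto_compose[OF continuous_on_product_coordinates[of v] F'(3)]) auto
    then have "strictly_minimal V E f w s"
      using F' F by (intro cluster_point_strictly_minimal[OF dag w, of F' f h]) (auto intro: h order.trans)
    with F' lim show ?thesis by blast
  qed
  obtain s where s: "strictly_minimal V E f w s"
    using cluster[of at_top] by auto
  have "((\<lambda>p. h p v) \<longlongrightarrow> s v) at_top" if v: "v \<in> V" for v
  proof (rule ccontr)
    assume "\<not> ?thesis"
    then obtain \<epsilon> where \<epsilon>: "\<epsilon> > 0" "\<not> (\<forall>\<^sub>F p in at_top. dist (h p v) (s v) < \<epsilon>)"
      unfolding tendsto_iff by blast
    \<comment> \<open>The filter is restricted to those \<open>p\<close> at which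
      \<open>h p v\<close> stays away from \<open>s v\<close>; a cluster point along it would have
      to differ from \<open>s\<close> at \<open>v\<close>.\<close>
    define F where "F = inf at_top (principal {p. \<not> dist (h p v) (s v) < \<epsilon>})"
    have "F \<noteq> bot" "F \<le> at_top"
      using \<epsilon>(2) by (auto simp: F_def trivial_limit_def eventually_inf_principal)
    then obtain s' F' where F': "F' \<le> F" "F' \<noteq> bot" "((\<lambda>p. h p v) \<longlongrightarrow> s' v) F'" "strictly_minimal V E f w s'"
      using cluster by blast
    have "\<forall>\<^sub>F p in F'. dist (h p v) (s v) < \<epsilon>"
      using F'(3) strictly_minimal_unique[OF finV s F'(4) v] \<epsilon>(1) by (auto simp: tendsto_iff)
    moreover have "\<forall>\<^sub>F p in F'. \<not> dist (h p v) (s v) < \<epsilon>"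
      by (rule filter_leD[OF F'(1)]) (auto simp: F_def eventually_inf_principal)
    ultimately have "\<forall>\<^sub>F p in F'. False"
      by eventually_elim simp
    then show False
      using F'(2) by (simp add: trivial_limit_def)
  qed
  then have "strict_isoreg V E f w s"
    unfolding strict_isoreg_def using h(1) by blast
  with s show ?thesis by blast
qed

subsection \<open>The lexicographic order\<close>

text \<open>The deciding threshold is the largest error \<gamma> of \<open>h\<close> on the
  difference set. Above it only vertices of agreement count; at \<gamma> itself \<open>y\<close>
  counts for \<open>h\<close>, but no vertex of disagreement counts for \<open>s\<close>.\<close>

lemma strictly_minimal_lex_less:
  assumes finV: "finite V" and w: "weight_fun V w" and s: "strictly_minimal V E f w s"
    and h: "isotonic E h" and x: "x \<in> V" "h x \<noteq> s x"
  shows "lex_less V f w s h"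
proof -
  obtain y where y: "y \<in> V" "h y \<noteq> s y"
    "\<And>v. v \<in> V \<Longrightarrow> h v \<noteq> s v \<Longrightarrow> werr f w h v \<le> werr f w h y"
    using finite_argmax[of V x "\<lambda>v. h v \<noteq> s v" "werr f w h"] finV x by blast
  define \<gamma> where "\<gamma> = werr f w h y"
  have lt: "werr f w s v < \<gamma>" if "v \<in> V" "h v \<noteq> s v" for v
    using strictly_minimalD[OF s h, of \<gamma>] y(3) that unfolding \<gamma>_def by blast
  have ew: "err_weight V f w g \<beta> = sum w {v\<in>V. \<beta> \<le> werr f w g v}" for g \<beta>
    by (simp add: err_weight_def werr_def abs_minus_commute)
  have same: "werr f w s v = werr f w h v" if "h v = s v" for v
    using that by (simp add: werr_def)
  have wpos: "w v > 0" if "v \<in> V" for v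
    using w that by (auto simp: weight_fun_def)
  have "0 \<le> werr f w s y"
    by (rule werr_nonneg[OF w y(1)])
  then have "\<gamma> > 0"
    using lt[OF y(1,2)] by simp
  moreover have "err_weight V f w s \<gamma> < err_weight V f w h \<gamma>"
    unfolding ew
  proof (rule sum_strict_mono2)
    show "{v \<in> V. \<gamma> \<le> werr f w s v} \<subseteq> {v \<in> V. \<gamma> \<le> werr f w h v}"
      using lt same by force
    show "y \<in> {v \<in> V. \<gamma> \<le> werr f w h v} - {v \<in> V. \<gamma> \<le> werr f w s v}"
      using lt[OF y(1,2)] y(1) by (simp add: \<gamma>_def)
  qed (use finV wpos y in \<open>auto intro: less_imp_le\<close>)
  moreover have "err_weight V f w s \<beta> = err_weight V f w h \<beta>" if "\<beta> > \<gamma>" for \<beta>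
  proof -
    have "{v \<in> V. \<beta> \<le> werr f w s v} = {v \<in> V. \<beta> \<le> werr f w h v}"
      using lt same y(3) that unfolding \<gamma>_def by force
    then show ?thesis
      by (simp add: ew)
  qed
  ultimately show ?thesis
    unfolding lex_less_def by blast
qed

lemma lex_less_asym: "lex_less V f w g h \<Longrightarrow> \<not> lex_less V f w h g"
  unfolding lex_less_def by (metis less_asym less_irrefl linorder_neqE)

text \<open>This covers competitors that agree with \<open>s\<close> on \<open>V\<close> but
  possibly not elsewhere.\<close>

lemma lex_less_cong:
  assumes "\<And>v. v \<in> V \<Longrightarrow> g v = g' v"
  shows "lex_less V f w g h \<longleftrightarrow> lex_less V f w g' h"
proof -
  have "{v\<in>V. \<alpha> \<le> w v * \<bar>g v - f v\<bar>} = {v\<in>V. \<alpha> \<le> w v * \<bar>g' v - f v\<bar>}" for \<alpha>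
    using assms by auto
  then have "err_weight V f w g = err_weight V f w g'"
    by (auto simp: err_weight_def)
  then show ?thesis
    by (auto simp: lex_less_def)
qed

lemma strictly_minimal_lex_isoreg:
  assumes "finite V" "weight_fun V w" "strictly_minimal V E f w s"
  shows "lex_isoreg V E f w s"
proof -
  have less: "lex_less V f w s h" if "isotonic E h" "\<not> (\<forall>v\<in>V. h v = s v)" for h
    using strictly_minimal_lex_less[OF assms that(1)] that(2) by blast
  have "\<not> lex_less V f w h s" if "isotonic E h" for h
  proof (cases "\<forall>v\<in>V. h v = s v")
    case True
    then show ?thesis
      using lex_less_cong[of V h s f w s] lex_less_asym[of V f w s s] by blast
  next
    case False
    then show ?thesis
      using less[OF that] lex_less_asym by blast
  qed
  moreover have "isotonic E s"
    using assms(3) by (simp add: strictly_minimal_def)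
  ultimately show ?thesis
    using less unfolding lex_isoreg_def lex_minimal_def by blast
qed

subsection \<open>Duality\<close>

lemma isotonic_dual: "isotonic (E\<inverse>) (\<lambda>v. - g v) \<longleftrightarrow> isotonic E g"
  by (auto simp: isotonic_def trancl_converse)

lemma isotonic_dual': "isotonic (E\<inverse>) h \<longleftrightarrow> isotonic E (\<lambda>v. - h v)"
  using isotonic_dual[of E "\<lambda>v. - h v"] by simp

lemma werr_dual: "werr (\<lambda>v. - f v) w g v = werr f w (\<lambda>v. - g v) v"
proof -
  have "\<bar>- f v - g v\<bar> = \<bar>f v - (- g v)\<bar>" by linarith
  then show ?thesis by (simp only: werr_def)
qed

lemma Linf_err_werr: "Linf_err V f w g = (MAX v\<in>V. werr f w g v)"
  by (simp add: Linf_err_def werr_def)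

lemma strictly_minimal_dual:
  assumes "strictly_minimal V E f w s"
  shows "strictly_minimal V (E\<inverse>) (\<lambda>v. - f v) w (\<lambda>v. - s v)"
  unfolding strictly_minimal_def
proof (intro conjI allI impI ballI)
  show "isotonic (E\<inverse>) (\<lambda>v. - s v)"
    using assms by (simp add: isotonic_dual strictly_minimal_def)
next
  fix h \<gamma> v
  assume "isotonic (E\<inverse>) h" "\<forall>v\<in>V. h v \<noteq> - s v \<longrightarrow> werr (\<lambda>v. - f v) w h v \<le> \<gamma>"
    "v \<in> V" "h v \<noteq> - s v"
  then show "werr (\<lambda>v. - f v) w (\<lambda>v. - s v) v < \<gamma>"
    using strictly_minimalD[OF assms, of "\<lambda>v. - h v" \<gamma> v]
    by (auto simp: werr_dual isotonic_dual' minus_equation_iff)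
qed

text \<open>Conjugation by negation. It satisfies the same hypotheses on the reversed graph, so
  undershooting reduces to overshooting.\<close>

definition dual_operator :: "'a operator \<Rightarrow> 'a operator" where
  "dual_operator A f w v = - A (\<lambda>v. - f v) w v"

lemma finite_dag_dual: "finite_dag V E \<Longrightarrow> finite_dag V (E\<inverse>)"
  by (auto simp: finite_dag_def)

lemma Linf_isotonic_operator_dual:
  assumes "Linf_isotonic_operator V E A"
  shows "Linf_isotonic_operator V (E\<inverse>) (dual_operator A)"
  unfolding Linf_isotonic_operator_def Linf_isoreg_def is_arg_min_linorder
proof (intro allI impI conjI)
  fix f w assume w: "weight_fun V w"
  have A: "isotonic E (A (\<lambda>v. - f v) w)"
    "\<And>k. isotonic E k \<Longrightarrow> Linf_err V (\<lambda>v. - f v) w (A (\<lambda>v. - f v) w) \<le> Linf_err V (\<lambda>v. - f v) w k"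
    using assms w unfolding Linf_isotonic_operator_def Linf_isoreg_def is_arg_min_linorder by blast+
  show "isotonic (E\<inverse>) (dual_operator A f w)"
    using A(1) isotonic_dual[of E "A (\<lambda>v. - f v) w"] by (simp add: dual_operator_def[abs_def])
  fix k assume "isotonic (E\<inverse>) k"
  then show "Linf_err V f w (dual_operator A f w) \<le> Linf_err V f w k"
    using A(2)[of "\<lambda>v. - k v"] by (simp add: isotonic_dual' Linf_err_werr werr_dual dual_operator_def[abs_def])
qed

lemma monotonic_operator_dual:
  assumes "monotonic_operator V A"
  shows "monotonic_operator V (dual_operator A)"
  using assms unfolding monotonic_operator_def dual_operator_def by simp

text \<open>Weak connectivity ignores the direction of edges, so both operators have the same level
  sets on negated data; the mean changes sign with the data.\<close>

lemma preserves_level_set_trimming_dual: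
  assumes "preserves_level_set_trimming V E A"
  shows "preserves_level_set_trimming V (E\<inverse>) (dual_operator A)"
  unfolding preserves_level_set_trimming_def
proof (intro allI impI ballI)
  fix f w L v
  assume w: "weight_fun V w" and L: "level_set V (E\<inverse>) (dual_operator A f w) L" and v: "v \<in> L"
  have "level_set V E (A (\<lambda>v. - f v) w) L"
    using L unfolding level_set_def weakly_connected_def dual_operator_def
    by (simp only: neg_equal_iff_equal converse_converse Un_commute[of "E\<inverse>" E])
  then have mean: "Linf_mean L (\<lambda>v. - f v) w (A (\<lambda>v. - f v) w v)"
    using assms w v unfolding preserves_level_set_trimming_def by blast
  have neg: "\<bar>- f u - y\<bar> = \<bar>f u - (- y)\<bar>" for u y
    by linarith
  have "(MAX u\<in>L. w u * \<bar>- f u - A (\<lambda>v. - f v) w v\<bar>) \<le> (MAX u\<in>L. w u * \<bar>- f u - (- z)\<bar>)" for z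
    using mean unfolding Linf_mean_def is_arg_min_linorder by blast
  then have "(MAX u\<in>L. w u * \<bar>f u - (- A (\<lambda>v. - f v) w v)\<bar>) \<le> (MAX u\<in>L. w u * \<bar>f u - z\<bar>)" for z
    unfolding neg minus_minus .
  then show "Linf_mean L f w (dual_operator A f w v)"
    unfolding Linf_mean_def is_arg_min_linorder dual_operator_def by blast
qed

subsection \<open>Comparison with the operator\<close>

text \<open>Otherwise a slight decrease of \<open>c\<close> would lower the maximal error
  \<open>m\<close>: errors with \<open>f v\<close> below the value shrink, and those with
  \<open>f v\<close> above it start strictly below \<open>\<alpha> \<le> m\<close>.\<close>

lemma Linf_mean_balanced:
  assumes fin: "finite L" and w: "\<And>v. v \<in> L \<Longrightarrow> 0 < w v" and mean: "Linf_mean L f w c"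
    and x: "x \<in> L" "\<alpha> \<le> w x * (c - f x)" and "0 < \<alpha>"
  shows "\<exists>y\<in>L. \<alpha> \<le> w y * (f y - c)"
proof (rule ccontr)
  assume "\<not> ?thesis"
  then have lt: "w y * (f y - c) < \<alpha>" if "y \<in> L" for y
    using that by force
  define m where "m = (MAX v\<in>L. w v * \<bar>f v - c\<bar>)"
  have le_m: "w v * \<bar>f v - c\<bar> \<le> m" if "v \<in> L" for v
    unfolding m_def using fin that by (intro Max_ge) auto
  have "w x * (c - f x) \<le> w x * \<bar>f x - c\<bar>"
    using w[OF x(1)] by (intro mult_left_mono) auto
  with x(2) le_m[OF x(1)] have "\<alpha> \<le> m" by simp
  have "\<forall>\<^sub>F t in at_right 0. \<forall>v\<in>L. w v * \<bar>f v - (c - t)\<bar> < m"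
  proof (rule eventually_ball_finite[OF fin], rule ballI)
    fix v assume v: "v \<in> L"
    have lim: "((\<lambda>t. w v * (f v - (c - t))) \<longlongrightarrow> w v * (f v - (c - 0))) (at_right 0)"
      by (intro tendsto_intros)
    have 1: "\<forall>\<^sub>F t in at_right 0. w v * (f v - (c - t)) < m"
      by (rule order_tendstoD[OF lim]) (use lt[OF v] \<open>\<alpha> \<le> m\<close> in simp)
    have "\<forall>\<^sub>F t in at_right 0. (0::real) < t"
      by (simp add: eventually_at_right_less)
    with 1 show "\<forall>\<^sub>F t in at_right 0. w v * \<bar>f v - (c - t)\<bar> < m"
    proof eventually_elim
      case (elim t)
      have "w v * (c - t - f v) < w v * (c - f v)"
        using w[OF v] elim by (intro mult_strict_left_mono) auto
      also have "\<dots> \<le> w v * \<bar>f v - c\<bar>"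
        using w[OF v] by (intro mult_left_mono) auto
      also have "\<dots> \<le> m" by (rule le_m[OF v])
      finally show ?case
        using elim by (auto simp: abs_if)
    qed
  qed
  then obtain t where t: "\<And>v. v \<in> L \<Longrightarrow> w v * \<bar>f v - (c - t)\<bar> < m"
    using eventually_happens'[OF trivial_limit_at_right_real] by blast
  have "(MAX v\<in>L. w v * \<bar>f v - (c - t)\<bar>) < m"
    using fin x(1) t by (subst Max_less_iff) auto
  then show False
    using mean unfolding Linf_mean_def is_arg_min_linorder m_def by (metis not_less)
qed

lemma level_set_exists:
  assumes "finite V" "x \<in> V"
  obtains L where "level_set V E g L" "x \<in> L" "L \<subseteq> V" "\<And>v. v \<in> L \<Longrightarrow> g v = g x"
proof -
  define P where "P S \<longleftrightarrow> S \<subseteq> V \<and> weakly_connected E S \<and> (\<forall>u\<in>S. \<forall>v\<in>S. g u = g v)" for S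
  have fin: "finite (Collect P)"
    by (rule finite_subset[of _ "Pow V"]) (use assms in \<open>auto simp: P_def\<close>)
  have "P {x}"
    using assms by (simp add: P_def weakly_connected_def)
  then obtain L where L: "P L" "x \<in> L" "\<forall>M. P M \<longrightarrow> L \<subseteq> M \<longrightarrow> M = L"
    using finite_has_maximal2[OF fin, of "{x}"] by auto
  then have "level_set V E g L"
    unfolding level_set_def Let_def P_def[symmetric] by blast
  moreover have "L \<subseteq> V" "\<And>v. v \<in> L \<Longrightarrow> g v = g x"
    using L(1,2) unfolding P_def by blast+
  ultimately show thesis
    using that L(2) by blast
qed

text \<open>The reference function \<open>k\<close> is \<open>s\<close> below \<open>c\<close> and
  the new constant \<open>M\<close> elsewhere, where its error vanishes. A large error of
  \<open>k\<close> at a vertex where it differs from \<open>s'\<close> would allow \<open>s\<close>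
  to be improved by moving it slightly towards \<open>s'\<close> on the part below \<open>c\<close>.
  The second claim keeps the count in the later induction from growing.\<close>

lemma strictly_minimal_raise:
  assumes dag: "finite_dag V E" and w: "weight_fun V w" and s: "strictly_minimal V E f w s"
    and M: "\<forall>v\<in>V. s v \<le> M"
    and f': "f' = (\<lambda>v. if s v < c then f v else M)"
    and s': "strictly_minimal V E f' w s'" and "\<alpha> > 0"
  shows "\<And>v. v \<in> V \<Longrightarrow> s v < c \<Longrightarrow> \<alpha> \<le> werr f w s v \<Longrightarrow> s' v = s v"
    and "{v\<in>V. \<alpha> \<le> werr f' w s' v} = {v\<in>V. s v < c \<and> \<alpha> \<le> werr f w s v}"
proof -
  have finV: "finite V" and sub: "E\<^sup>+ \<subseteq> V \<times> V"
    using dag trancl_subset_Sigma[of E V] by (auto simp: finite_dag_def)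
  have wpos: "w v > 0" if "v \<in> V" for v
    using w that by (auto simp: weight_fun_def)
  have siso: "isotonic E s" "isotonic E s'"
    using s s' by (auto simp: strictly_minimal_def)
  define k where "k = (\<lambda>v. if s v < c then s v else M)"
  have kiso: "isotonic E k"
    using siso(1) sub M unfolding isotonic_def k_def by force
  have ek: "werr f' w k v = (if s v < c then werr f w s v else 0)" for v
    by (simp add: werr_def f' k_def)
  have small: "werr f' w k v < \<alpha>" if v: "v \<in> V" "k v \<noteq> s' v" for v
  proof (rule ccontr)
    assume ge: "\<not> werr f' w k v < \<alpha>"
    obtain y where y: "y \<in> V" "k y \<noteq> s' y"
      "\<And>v. v \<in> V \<Longrightarrow> k v \<noteq> s' v \<Longrightarrow> werr f' w k v \<le> werr f' w k y"
      using finite_argmax[of V v "\<lambda>v. k v \<noteq> s' v" "werr f' w k"] finV v by blast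
    define \<gamma> where "\<gamma> = werr f' w k y"
    have "\<alpha> \<le> \<gamma>"
      using y(3)[OF v] ge by (simp add: \<gamma>_def)
    then have yc: "s y < c" "werr f w s y = \<gamma>"
      using ek[of y] \<open>\<alpha> > 0\<close> by (auto simp: \<gamma>_def split: if_splits)
    have lt: "werr f' w s' u < \<gamma>" if "u \<in> V" "k u \<noteq> s' u" for u
      using strictly_minimalD[OF s' kiso, of \<gamma>] y(3) that unfolding \<gamma>_def by blast
    \<comment> \<open>A small \<open>t\<close> keeps the moved values below \<open>c\<close>, so
      gluing them to \<open>s\<close> on the part where \<open>s\<close> is at least
      \<open>c\<close> preserves isotonicity.\<close>
    have "\<forall>\<^sub>F t in at_right (0::real). \<forall>u\<in>V. s u < c \<longrightarrow> s u + t * (s' u - s u) < c"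
    proof (rule eventually_ball_finite[OF finV], rule ballI)
      fix u
      have lim: "((\<lambda>t. s u + t * (s' u - s u)) \<longlongrightarrow> s u + 0 * (s' u - s u)) (at_right 0)"
        by (intro tendsto_intros)
      show "\<forall>\<^sub>F t in at_right (0::real). s u < c \<longrightarrow> s u + t * (s' u - s u) < c"
        using order_tendstoD(2)[OF lim, of c] by (cases "s u < c") auto
    qed
    moreover have "\<forall>\<^sub>F t in at_right (0::real). t \<in> {0<..<1}"
      by (rule eventually_at_right_real) simp
    ultimately have "\<forall>\<^sub>F t in at_right (0::real).
        (\<forall>u\<in>V. s u < c \<longrightarrow> s u + t * (s' u - s u) < c) \<and> t \<in> {0<..<1}"
      by eventually_elim simp
    then obtain t where t: "\<And>u. u \<in> V \<Longrightarrow> s u < c \<Longrightarrow> s u + t * (s' u - s u) < c" "0 < t" "t < 1"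
      using eventually_happens'[OF trivial_limit_at_right_real] by fastforce
    define h where "h = (\<lambda>u. if s u < c then s u + t * (s' u - s u) else s u)"
    have "isotonic E h"
      unfolding isotonic_def
    proof (intro allI impI)
      fix u v assume uv: "(u, v) \<in> E\<^sup>+"
      then have le: "s u \<le> s v" "s' u \<le> s' v" and V: "u \<in> V" "v \<in> V"
        using siso sub by (auto simp: isotonic_def)
      have "(1 - t) * s u + t * s' u \<le> (1 - t) * s v + t * s' v"
        using le t by (intro add_mono mult_left_mono) auto
      then show "h u \<le> h v"
        using le t(1)[OF V(1)] by (auto simp: h_def algebra_simps)
    qed
    \<comment> \<open>Convexity of the error: at such \<open>u\<close> the errors of
      \<open>s\<close> and \<open>s'\<close> are both at most \<gamma>.\<close>
    moreover have "werr f w h u \<le> \<gamma>" if u: "u \<in> V" "h u \<noteq> s u" for u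
    proof -
      have uc: "s u < c" "k u \<noteq> s' u"
        using u(2) by (auto simp: h_def k_def split: if_splits)
      have 1: "w u * \<bar>f u - s u\<bar> \<le> \<gamma>"
        using y(3)[OF u(1) uc(2)] uc(1) unfolding ek[of u] by (simp add: \<gamma>_def werr_def)
      have 2: "w u * \<bar>f u - s' u\<bar> \<le> \<gamma>"
        using lt[OF u(1) uc(2)] uc(1) by (simp add: werr_def f')
      have "\<bar>f u - h u\<bar> = \<bar>(1 - t) * (f u - s u) + t * (f u - s' u)\<bar>"
        using uc(1) by (simp add: h_def algebra_simps)
      also have "\<dots> \<le> (1 - t) * \<bar>f u - s u\<bar> + t * \<bar>f u - s' u\<bar>"
        using t abs_triangle_ineq[of "(1 - t) * (f u - s u)" "t * (f u - s' u)"]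
        by (simp add: abs_mult)
      finally have "w u * \<bar>f u - h u\<bar> \<le> w u * ((1 - t) * \<bar>f u - s u\<bar> + t * \<bar>f u - s' u\<bar>)"
        using wpos[OF u(1)] by simp
      also have "\<dots> = (1 - t) * (w u * \<bar>f u - s u\<bar>) + t * (w u * \<bar>f u - s' u\<bar>)"
        by (simp add: algebra_simps)
      also have "\<dots> \<le> \<gamma>"
        using 1 2 t by (intro convex_bound_le) auto
      finally show ?thesis
        by (simp add: werr_def)
    qed
    moreover have "h y \<noteq> s y"
      using y(2) yc(1) t by (simp add: h_def k_def)
    ultimately have "werr f w s y < \<gamma>"
      using strictly_minimalD[OF s, of h \<gamma> y] y(1) by blast
    then show False
      using yc by simp
  qed
  have small': "werr f' w s' v < \<alpha>" if "v \<in> V" "k v \<noteq> s' v" for v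
    using strictly_minimalD[OF s' kiso, of \<alpha> v] small that by (simp add: less_imp_le)
  show eq: "s' v = s v" if "v \<in> V" "s v < c" "\<alpha> \<le> werr f w s v" for v
  proof (rule ccontr)
    assume "s' v \<noteq> s v"
    then have "werr f' w k v < \<alpha>"
      using small[OF that(1)] that(2) by (auto simp: k_def)
    then show False
      using that(2,3) by (simp add: ek)
  qed
  have same: "werr f' w s' v = werr f' w k v" if "k v = s' v" for v
    using that by (simp add: werr_def)
  show "{v\<in>V. \<alpha> \<le> werr f' w s' v} = {v\<in>V. s v < c \<and> \<alpha> \<le> werr f w s v}" (is "?L = ?R")
  proof (intro equalityI subsetI)
    fix v assume v: "v \<in> ?L"
    then have "k v = s' v"
      using small'[of v] by force
    then show "v \<in> ?R"
      using v same[of v] ek[of v] \<open>\<alpha> > 0\<close> by (auto split: if_splits)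
  next
    fix v assume v: "v \<in> ?R"
    then have "s' v = s v" using eq by blast
    then show "v \<in> ?L"
      using v by (auto simp: werr_def f')
  qed
qed

text \<open>The induction hypothesis is taken at the fixed threshold \<alpha> for all data with no
  more large errors than \<open>f\<close>, so that it applies to the raised data
  \<open>f'\<close>.\<close>

lemma no_overshoot:
  assumes dag: "finite_dag V E" and A: "Linf_isotonic_operator V E A"
    and mono: "monotonic_operator V A" and trim: "preserves_level_set_trimming V E A"
    and w: "weight_fun V w" and s: "strictly_minimal V E f w s" and "\<alpha> > 0"
    and IH: "\<And>f' s' v. strictly_minimal V E f' w s' \<Longrightarrow>
       card {v\<in>V. \<alpha> \<le> werr f' w s' v} \<le> card {v\<in>V. \<alpha> \<le> werr f w s v} \<Longrightarrow>
       v \<in> V \<Longrightarrow> \<alpha> \<le> werr f' w s' v \<Longrightarrow> A f' w v = s' v"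
    and x: "x \<in> V" "s x < A f w x" "\<alpha> \<le> w x * (A f w x - f x)"
  shows False
proof -
  have finV: "finite V" and sub: "E\<^sup>+ \<subseteq> V \<times> V"
    using dag trancl_subset_Sigma[of E V] by (auto simp: finite_dag_def)
  have wpos: "w v > 0" if "v \<in> V" for v
    using w that by (auto simp: weight_fun_def)
  define c where "c = A f w x"
  define B where "B = (\<Sum>v\<in>V. werr f w s v)"
  have B: "werr f w s v \<le> B" if "v \<in> V" for v
    unfolding B_def using that werr_nonneg[OF w]
    by (intro member_le_sum[OF _ _ finV]) auto
  have B0: "0 \<le> B"
    unfolding B_def using werr_nonneg[OF w] by (intro sum_nonneg)
  \<comment> \<open>The last condition on \<open>M\<close> separates raised vertices from
    \<open>x\<close>: their values under \<open>g'\<close> are at least \<open>M - B / w v\<close>,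
    while that of \<open>x\<close> is at most \<open>f x + B / w x\<close>.\<close>
  have "\<forall>\<^sub>F M in at_top. \<forall>v\<in>V. s v \<le> M \<and> f v \<le> M \<and> f x + B / w x + B / w v < M"
    by (intro eventually_ball_finite[OF finV] ballI eventually_conj eventually_ge_at_top eventually_gt_at_top)
  then obtain M where M: "\<forall>v\<in>V. s v \<le> M" "\<And>v. v \<in> V \<Longrightarrow> f v \<le> M"
      "\<And>v. v \<in> V \<Longrightarrow> f x + B / w x + B / w v < M"
    using eventually_happens'[OF trivial_limit_at_top_linorder] by blast
  define f' where "f' = (\<lambda>v. if s v < c then f v else M)"
  define g' where "g' = A f' w"
  obtain s' where s': "strictly_minimal V E f' w s'"
    using Lp_limit_strictly_minimal[OF dag w] by blast
  note raise = strictly_minimal_raise[OF dag w s M(1) f'_def s' \<open>\<alpha> > 0\<close>]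
  have high: "g' v = s v" if "v \<in> V" "s v < c" "\<alpha> \<le> werr f w s v" for v
  proof -
    have "card {v\<in>V. \<alpha> \<le> werr f' w s' v} \<le> card {v\<in>V. \<alpha> \<le> werr f w s v}"
      unfolding raise(2) using finV by (intro card_mono) auto
    moreover have "\<alpha> \<le> werr f' w s' v"
      using raise(2) that by blast
    ultimately show ?thesis
      using IH[OF s'] raise(1) that by (simp add: g'_def)
  qed
  have "\<forall>v\<in>V. f v \<le> f' v"
    using M(2) by (simp add: f'_def)
  then have ge: "c \<le> g' x"
    using mono w x(1) unfolding monotonic_operator_def c_def g'_def by blast
  have xc: "s x < c" "f' x = f x"
    using x by (auto simp: c_def f'_def)
  \<comment> \<open>The bound \<open>B\<close> must not depend on \<open>M\<close>. It comes from
    the isotonic competitor \<open>k\<close>, which has error zero on the raised vertices and the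
    errors of \<open>s\<close> on the others.\<close>
  have errB: "w v * \<bar>f' v - g' v\<bar> \<le> B" if "v \<in> V" for v
  proof -
    define k where "k = (\<lambda>v. if s v < c then s v else M)"
    have "isotonic E k"
      using s sub M(1) unfolding strictly_minimal_def isotonic_def k_def by force
    then have "Linf_err V f' w g' \<le> Linf_err V f' w k"
      using A w unfolding Linf_isotonic_operator_def Linf_isoreg_def is_arg_min_linorder g'_def by blast
    also have "\<dots> \<le> B"
      unfolding Linf_err_def using finV x(1) B B0
      by (subst Max_le_iff) (auto simp: k_def f'_def werr_def)
    finally have "Linf_err V f' w g' \<le> B" .
    moreover have "w v * \<bar>f' v - g' v\<bar> \<le> Linf_err V f' w g'"
      unfolding Linf_err_def using finV that by (intro Max_ge) auto
    ultimately show ?thesis by simp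
  qed
  have absB: "\<bar>f' v - g' v\<bar> \<le> B / w v" if "v \<in> V" for v
    using errB[OF that] wpos[OF that] by (simp add: field_simps)
  obtain L where L: "level_set V E g' L" "x \<in> L" "L \<subseteq> V" "\<And>v. v \<in> L \<Longrightarrow> g' v = g' x"
    using level_set_exists[OF finV x(1)] by blast
  have "Linf_mean L f' w (g' x)"
    using trim w L(1,2) unfolding preserves_level_set_trimming_def g'_def by blast
  moreover have "\<alpha> \<le> w x * (g' x - f' x)"
  proof -
    have "w x * (c - f x) \<le> w x * (g' x - f' x)"
      using ge xc wpos[OF x(1)] by (intro mult_left_mono) auto
    with x(3) show ?thesis by (simp add: c_def)
  qed
  ultimately obtain y where y: "y \<in> L" "\<alpha> \<le> w y * (f' y - g' x)"
    using Linf_mean_balanced[of L w f' "g' x" x \<alpha>] L(2,3) finV wpos \<open>\<alpha> > 0\<close>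
    by (meson finite_subset subsetD)
  have yV: "y \<in> V" using y L(3) by blast
  have yc: "s y < c"
  proof (rule ccontr)
    assume "\<not> s y < c"
    then have "M - B / w y \<le> g' y"
      using absB[OF yV] by (simp add: f'_def)
    moreover have "g' x \<le> f x + B / w x"
      using absB[OF x(1)] xc(2) by linarith
    ultimately show False
      using L(4)[OF y(1)] M(3)[OF yV] by linarith
  qed
  show False
  proof (cases "\<alpha> \<le> werr f w s y")
    case True
    then show False
      using high[OF yV yc] L(4)[OF y(1)] ge yc by simp
  next
    case False
    \<comment> \<open>Since \<open>s y < c \<le> g' x\<close>, the value of \<open>s\<close> lies
      farther below \<open>f y\<close> than \<open>g' x\<close> does, so the error of
      \<open>s\<close> at \<open>y\<close> would be at least \<alpha> after all.\<close>
    have "w y * (f' y - g' x) \<le> w y * \<bar>f y - s y\<bar>"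
      using yc ge wpos[OF yV] by (intro mult_left_mono) (auto simp: f'_def)
    with False y(2) show False
      by (simp add: werr_def)
  qed
qed

text \<open>The threshold varies in the induction. A disagreement at \<open>v\<close> produces a
  higher threshold \<gamma> above the error of \<open>s\<close> at \<open>v\<close>, so
  \<open>v\<close> drops out of the count.\<close>

lemma operator_eq_on_large_errors:
  assumes dag: "finite_dag V E" and A: "Linf_isotonic_operator V E A"
    and mono: "monotonic_operator V A" and trim: "preserves_level_set_trimming V E A"
    and w: "weight_fun V w" and s: "strictly_minimal V E f w s"
    and v: "v \<in> V" "\<alpha> \<le> werr f w s v"
  shows "A f w v = s v"
  using s v
proof (induction "card {v\<in>V. \<alpha> \<le> werr f w s v}" arbitrary: f s \<alpha> v rule: less_induct)
  case less
  have finV: "finite V"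
    using dag by (auto simp: finite_dag_def)
  have wpos: "w v > 0" if "v \<in> V" for v
    using w that by (auto simp: weight_fun_def)
  define g where "g = A f w"
  have giso: "isotonic E g"
    using A w unfolding Linf_isotonic_operator_def Linf_isoreg_def is_arg_min_linorder g_def by blast
  show ?case
  proof (rule ccontr)
    assume "A f w v \<noteq> s v"
    then have ne: "g v \<noteq> s v" by (simp add: g_def)
    obtain x where x: "x \<in> V" "g x \<noteq> s x"
      "\<And>v. v \<in> V \<Longrightarrow> g v \<noteq> s v \<Longrightarrow> werr f w g v \<le> werr f w g x"
      using finite_argmax[of V v "\<lambda>v. g v \<noteq> s v" "werr f w g"] finV less.prems(2) ne by blast
    define \<gamma> where "\<gamma> = werr f w g x"
    have lt: "werr f w s u < \<gamma>" if "u \<in> V" "g u \<noteq> s u" for u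
      using strictly_minimalD[OF less.prems(1) giso, of \<gamma>] x(3) that unfolding \<gamma>_def by blast
    have "0 \<le> werr f w s x"
      by (rule werr_nonneg[OF w x(1)])
    then have "\<gamma> > 0"
      using lt[OF x(1,2)] by simp
    have "\<alpha> < \<gamma>"
      using lt[OF less.prems(2) ne] less.prems(3) by simp
    then have "{v\<in>V. \<gamma> \<le> werr f w s v} \<subseteq> {v\<in>V. \<alpha> \<le> werr f w s v}"
      by auto
    moreover have "v \<in> {v\<in>V. \<alpha> \<le> werr f w s v}" "v \<notin> {v\<in>V. \<gamma> \<le> werr f w s v}"
      using lt[OF less.prems(2) ne] less.prems(2,3) by auto
    ultimately have card: "card {v\<in>V. \<gamma> \<le> werr f w s v} < card {v\<in>V. \<alpha> \<le> werr f w s v}"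
      using finV by (intro psubset_card_mono) auto
    have IH: "A f' w u = s' u"
      if "strictly_minimal V E f' w s'" "card {v\<in>V. \<gamma> \<le> werr f' w s' v} \<le> card {v\<in>V. \<gamma> \<le> werr f w s v}"
        "u \<in> V" "\<gamma> \<le> werr f' w s' u" for f' s' u
      using less.hyps[OF _ that(1,3,4)] that(2) card by simp
    have close: "\<bar>f x - s x\<bar> < \<bar>f x - g x\<bar>"
      using lt[OF x(1,2)] wpos[OF x(1)] by (simp add: \<gamma>_def werr_def)
    show False
    proof (cases "f x < g x")
      case True
      show False
      proof (rule no_overshoot[OF dag A mono trim w less.prems(1) \<open>\<gamma> > 0\<close> _ x(1)])
        show "s x < A f w x" "\<gamma> \<le> w x * (A f w x - f x)"
          using close True by (auto simp: g_def[symmetric] \<gamma>_def werr_def)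
      qed (rule IH)
    next
      case False
      have IH': "dual_operator A f' w u = s' u"
        if h: "strictly_minimal V (E\<inverse>) f' w s'"
          "card {v\<in>V. \<gamma> \<le> werr f' w s' v} \<le> card {v\<in>V. \<gamma> \<le> werr (\<lambda>v. - f v) w (\<lambda>v. - s v) v}"
          "u \<in> V" "\<gamma> \<le> werr f' w s' u" for f' s' u
      proof -
        have neg: "werr (\<lambda>v. - a v) w (\<lambda>v. - b v) = werr a w b" for a b
          by (auto simp: werr_dual)
        have "A (\<lambda>v. - f' v) w u = - s' u"
          using strictly_minimal_dual[OF h(1)] h(2-4)
          by (intro IH[of "\<lambda>v. - f' v" "\<lambda>v. - s' v"]) (simp_all add: neg)
        then show ?thesis
          by (simp add: dual_operator_def)
      qed
      have dg: "dual_operator A (\<lambda>v. - f v) w x = - g x"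
        by (simp add: dual_operator_def g_def)
      show False
      proof (rule no_overshoot[OF finite_dag_dual[OF dag] Linf_isotonic_operator_dual[OF A]
            monotonic_operator_dual[OF mono] preserves_level_set_trimming_dual[OF trim] w
            strictly_minimal_dual[OF less.prems(1)] \<open>\<gamma> > 0\<close> _ x(1)])
        show "- s x < dual_operator A (\<lambda>v. - f v) w x"
          "\<gamma> \<le> w x * (dual_operator A (\<lambda>v. - f v) w x - - f x)"
          using close False by (auto simp: dg \<gamma>_def werr_def)
      qed (rule IH')
    qed
  qed
qed

text \<open>Agreement with \<open>s\<close> is known on \<open>V\<close> only; this suffices because
  all edges lie within \<open>V\<close>.\<close>

lemma strictly_minimal_cong:
  assumes "E \<subseteq> V \<times> V" "\<And>v. v \<in> V \<Longrightarrow> g v = s v" "strictly_minimal V E f w s"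
  shows "strictly_minimal V E f w g"
proof -
  have "isotonic E g"
    using assms trancl_subset_Sigma[OF assms(1)] unfolding strictly_minimal_def isotonic_def by force
  then show ?thesis
    using assms(2,3) unfolding strictly_minimal_def by (simp add: werr_def)
qed

theorem theorem1:
  fixes V :: "'a set" and E :: "('a \<times> 'a) set" and A :: "'a operator"
  assumes "finite_dag V E"
    and "Linf_isotonic_operator V E A"
    and "monotonic_operator V A"
    and "preserves_level_set_trimming V E A"
  shows "\<forall>f w. weight_fun V w \<longrightarrow>
           strict_isoreg V E f w (A f w) \<and> lex_isoreg V E f w (A f w)"
proof (intro allI impI)
  fix f w assume w: "weight_fun V w"
  obtain s where s: "strictly_minimal V E f w s" "strict_isoreg V E f w s"
    using Lp_limit_strictly_minimal[OF assms(1) w] by blast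
  \<comment> \<open>The threshold is the error of \<open>s\<close> at \<open>v\<close> itself, so
    every vertex is covered.\<close>
  have eq: "A f w v = s v" if "v \<in> V" for v
    using operator_eq_on_large_errors[OF assms w s(1) that order_refl] .
  have "strictly_minimal V E f w (A f w)"
    using assms(1) eq s(1) by (intro strictly_minimal_cong[of E V "A f w" s]) (auto simp: finite_dag_def)
  moreover have "strict_isoreg V E f w (A f w)"
    using s(2) eq unfolding strict_isoreg_def by simp
  ultimately show "strict_isoreg V E f w (A f w) \<and> lex_isoreg V E f w (A f w)"
    using strictly_minimal_lex_isoreg[OF _ w] assms(1) by (auto simp: finite_dag_def)
qed

end
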